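(* Let $k \ge 3$ be a positive integer. Select $k$ sticks whose lengths are chosen independently from a uniform distribution of stick lengths on an interval $(0,L)$, where $L > 0$ is fixed. The probability that the resulting $k$ sticks form a $k$-gon is $$1-\frac{1}{(k-1)!}.$$
   Context: The sample space is the cube $(0,L)^k$ of vectors $(x_1,\ldots,x_k)$ of stick lengths, with normalized Lebesgue measure. The $k$ sticks "form a $k$-gon" if there exists a (convex) nondegenerate planar polygon (i.e., with nonempty interior) with $k$ sides whose multiset of side lengths is $\{x_1,\ldots,x_k\}$. The sides may be arranged in any order. *)

theory Defs
  imports "HOL-Probability.Probability"
begin

text \<open>
  A convex polygon with nonempty interior is a full-dimensional polytope in the plane, and its sides
  are the one-dimensional faces. The length of a side, being a segment, is its
  diameter. Equality of multisets says that there are exactly \<open>k\<close> sides and that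
  their lengths are the given ones, in whatever cyclic order. Vertices of a polytope are
  extreme points, so straight angles do not occur.
\<close>
definition forms_polygon :: "nat \<Rightarrow> (nat \<Rightarrow> real) \<Rightarrow> bool" where
  "forms_polygon k x \<longleftrightarrow>
     (\<exists>P :: (real ^ 2) set.
        polytope P \<and> interior P \<noteq> {} \<and>
        image_mset diameter (mset_set {e. e edge_of P}) = image_mset x (mset_set {..<k}))"

text \<open>The cube of length vectors with normalized Lebesgue measure.\<close>
definition stick_space :: "nat \<Rightarrow> real \<Rightarrow> (nat \<Rightarrow> real) measure" where
  "stick_space k L =
     uniform_measure (\<Pi>\<^sub>M i\<in>{..<k}. lborel) (\<Pi>\<^sub>E i\<in>{..<k}. {0<..<L})"

text \<open>Equivalently, the lengths are independent and uniform on the interval.\<close>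
lemma stick_space_eq_PiM:
  assumes "L > 0"
  shows "stick_space k L = (\<Pi>\<^sub>M i\<in>{..<k}. uniform_measure lborel {0<..<L})"
proof -
  let ?U = "uniform_measure lborel {0<..<L}"
  let ?C = "\<Pi>\<^sub>E i\<in>{..<k}. {0<..<L}"
  interpret U: prob_space ?U
    using assms by (intro prob_space_uniform_measure) auto
  interpret P: product_sigma_finite "\<lambda>_::nat. ?U"
    by unfold_locales
  interpret B: product_sigma_finite "\<lambda>_::nat. lborel :: real measure"
    by unfold_locales
  have sets_eq: "sets (\<Pi>\<^sub>M i\<in>{..<k}. lborel) = sets (\<Pi>\<^sub>M i\<in>{..<k}. ?U)"
    by (intro sets_PiM_cong) auto
  have C: "?C \<in> sets (\<Pi>\<^sub>M i\<in>{..<k}. lborel :: real measure)"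
    by (intro sets_PiM_I_finite) auto
  show ?thesis
    unfolding stick_space_def
  proof (intro P.PiM_eqI)
    show "sets (uniform_measure (\<Pi>\<^sub>M i\<in>{..<k}. lborel) ?C) = sets (\<Pi>\<^sub>M i\<in>{..<k}. ?U)"
      using sets_eq by simp
  next
    fix A :: "nat \<Rightarrow> real set"
    assume A: "\<And>i. i \<in> {..<k} \<Longrightarrow> A i \<in> sets ?U"
    have "emeasure (uniform_measure (\<Pi>\<^sub>M i\<in>{..<k}. lborel) ?C) (Pi\<^sub>E {..<k} A)
        = emeasure (\<Pi>\<^sub>M i\<in>{..<k}. lborel) (?C \<inter> Pi\<^sub>E {..<k} A) / emeasure (\<Pi>\<^sub>M i\<in>{..<k}. lborel) ?C"
      using A C by (intro emeasure_uniform_measure sets_PiM_I_finite) auto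
    also have "?C \<inter> Pi\<^sub>E {..<k} A = (\<Pi>\<^sub>E i\<in>{..<k}. {0<..<L} \<inter> A i)"
      by (rule PiE_Int)
    also have "emeasure (\<Pi>\<^sub>M i\<in>{..<k}. lborel) \<dots> = (\<Prod>i<k. emeasure lborel ({0<..<L} \<inter> A i))"
      using A by (intro B.emeasure_PiM) auto
    also have "emeasure (\<Pi>\<^sub>M i\<in>{..<k}. lborel :: real measure) ?C = (\<Prod>i<k. ennreal L)"
      using assms by (subst B.emeasure_PiM) auto
    also have "(\<Prod>i<k. emeasure lborel ({0<..<L} \<inter> A i)) / (\<Prod>i<k. ennreal L)
        = (\<Prod>i<k. emeasure lborel ({0<..<L} \<inter> A i) / ennreal L)"
      using assms
      by (simp add: divide_ennreal_def prod.distrib inverse_ennreal ennreal_power power_inverse)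
    also have "\<dots> = (\<Prod>i<k. emeasure ?U (A i))"
      using A assms by (intro prod.cong) auto
    finally show "emeasure (uniform_measure (\<Pi>\<^sub>M i\<in>{..<k}. lborel) ?C) (Pi\<^sub>E {..<k} A)
        = (\<Prod>i<k. emeasure ?U (A i))" .
  qed simp
qed

end

theory Submission
  imports Defs
begin

text \<open>
  Three or more sticks of positive length form a polygon exactly when every stick is shorter than all the
  others together, that is, shorter than half of the total length. Since the lengths in the
  cube are positive, at most one stick can violate this.

  Necessity (\<open>edge_shorter_than_other_edges\<close>) follows by projecting a polygon onto the line of one
  of its sides. The shadows of the other sides cover that side, and one of these shadows is
  strictly shorter than the side that casts it.

  Sufficiency (\<open>forms_polygonI\<close>) is shown by inscribing the sticks as consecutive chords in a
  circle. A suitable radius exists by the intermediate value theorem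
  (\<open>inscribed_half_angles\<close>). Points in increasing angular order on a circle are in strictly convex
  position, and the edges of their convex hull are the segments between consecutive points
  (\<open>ccw_polygon.edges_of_body\<close>).

  The criterion is an equivalence with strict inequalities, so the event is described exactly
  and its measurability is visible. Its complement in the cube splits into \<open>k\<close>
  disjoint parts, according to the stick that is at least half of the total. Each part is a pyramid
  over a corner simplex and has the fraction \<open>1 / fact k\<close> of the volume of the cube
  (\<open>emeasure_dominant_coordinate\<close>). The failure probability is therefore
  \<open>k / fact k = 1 / fact (k - 1)\<close>.
\<close>

section \<open>Sides of a polygon\<close>

lemma diameter_closed_segment:
  fixes a b :: "'a::euclidean_space"
  shows "diameter (closed_segment a b) = dist a b"
proof (rule antisym)
  have "norm (x - y) \<le> dist a b" if "x \<in> closed_segment a b" "y \<in> closed_segment a b" for x y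
  proof -
    have "dist y x \<le> dist y a \<or> dist y x \<le> dist y b"
      using that(1) by (metis dist_decreases_closed_segment)
    moreover have "dist y a \<le> dist a b" "dist y b \<le> dist a b"
      using dist_in_closed_segment[OF that(2)] by auto
    ultimately show ?thesis by (simp add: dist_norm norm_minus_commute) linarith
  qed
  then show "diameter (closed_segment a b) \<le> dist a b"
    by (intro diameter_le) auto
  show "dist a b \<le> diameter (closed_segment a b)"
    by (intro diameter_bounded_bound compact_imp_bounded) auto
qed

lemma edge_of_polytope_segment:
  assumes "polytope P" "e edge_of P"
  obtains a b where "a \<noteq> b" "e = closed_segment a b"
proof -
  have e: "e face_of P" "aff_dim e = 1" using assms(2) by (auto simp: edge_of_def)
  then have "polytope e" using assms(1) face_of_polytope_polytope by blast
  moreover have "e \<noteq> {}" using e(2) by auto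
  ultimately obtain a b where "e = closed_segment a b"
    using e(2) by (metis compact_convex_collinear_segment collinear_aff_dim order_refl
        polytope_imp_compact polytope_imp_convex)
  moreover have "a \<noteq> b" using e(2) calculation by auto
  ultimately show thesis using that by blast
qed

text \<open>The boundary of a polyhedron is covered by its facets, and in the plane the facets
  of a full-dimensional polytope are its edges.\<close>
lemma frontier_polygon_eq_Union_edges:
  fixes P :: "(real ^ 2) set"
  assumes "polytope P" "interior P \<noteq> {}"
  shows "frontier P = \<Union>{e. e edge_of P}"
proof -
  have "aff_dim P = 2"
    using assms(2) low_dim_interior[of P] by auto
  then have "{F. F facet_of P} = {e. e edge_of P}"
    by (auto simp: facet_of_def edge_of_def)
  then show ?thesis
    using assms rel_frontier_of_polyhedron[OF polytope_imp_polyhedron]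
    by (metis rel_frontier_nonempty_interior)
qed

lemma interior_inner_less:
  fixes P :: "'a::euclidean_space set"
  assumes "n \<noteq> 0" "P \<subseteq> {x. n \<bullet> x \<le> \<beta>}" "c \<in> interior P"
  shows "n \<bullet> c < \<beta>"
proof -
  have "interior P \<subseteq> interior {x. n \<bullet> x \<le> \<beta>}" by (rule interior_mono) fact
  then show ?thesis using assms by (auto simp: interior_halfspace_le)
qed

text \<open>Faces of polyhedra are exposed, which turns the abstract face condition into a linear
  functional that is maximal exactly on the edge.\<close>
lemma edge_supporting_line:
  fixes P :: "(real ^ 2) set"
  assumes "polytope P" "interior P \<noteq> {}" "e edge_of P"
  obtains n \<beta> where "n \<noteq> 0" "P \<subseteq> {x. n \<bullet> x \<le> \<beta>}" "e = P \<inter> {x. n \<bullet> x = \<beta>}"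
proof -
  have "aff_dim P = 2"
    using assms(2) low_dim_interior[of P] by auto
  moreover have "e face_of P" and d: "aff_dim e = 1" using assms(3) by (auto simp: edge_of_def)
  ultimately have "e \<noteq> P" "e \<noteq> {}" "e exposed_face_of P"
    using assms(1) exposed_face_of_polyhedron polytope_imp_polyhedron by auto
  then show thesis using that by (auto simp: exposed_face_of)
qed

section \<open>Every side is shorter than the rest of the perimeter\<close>

text \<open>The point \<open>q\<close> maximises \<open>v\<close> on the compact slice of \<open>P\<close> through \<open>w\<close>. Moving along \<open>v\<close>
  stays on the same level of \<open>n\<close>, so an interior point of \<open>P\<close> cannot be such a maximiser. This
  supplies frontier points with a prescribed value under a projection.\<close>
lemma frontier_point_on_level:
  fixes P :: "'a::euclidean_space set"
  assumes "compact P" "w \<in> P" "v \<noteq> 0" "n \<bullet> v = 0"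
  obtains q where "q \<in> frontier P" "n \<bullet> q = n \<bullet> w" "v \<bullet> q \<ge> v \<bullet> w"
proof -
  let ?K = "P \<inter> {x. n \<bullet> x = n \<bullet> w}"
  have "compact ?K" using assms(1) by (simp add: closed_hyperplane compact_Int_closed)
  moreover have "w \<in> ?K" using assms by auto
  moreover have "continuous_on ?K (\<lambda>x. v \<bullet> x)" by (intro continuous_intros)
  ultimately obtain q where q: "q \<in> ?K" "\<And>y. y \<in> ?K \<Longrightarrow> v \<bullet> y \<le> v \<bullet> q"
    using continuous_attains_sup[of ?K "\<lambda>x. v \<bullet> x"] by blast
  have "q \<notin> interior P"
  proof
    assume "q \<in> interior P"
    then obtain r where r: "r > 0" "cball q r \<subseteq> P" by (auto simp: mem_interior_cball)
    define y where "y = q + (r / norm v) *\<^sub>R v"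
    have "dist q y = r" using r assms(3) by (simp add: y_def dist_norm)
    then have "y \<in> P" using r by auto
    moreover have "n \<bullet> y = n \<bullet> w" using q assms by (simp add: y_def inner_add_right)
    ultimately have "v \<bullet> y \<le> v \<bullet> q" using q by auto
    moreover have "v \<bullet> y = v \<bullet> q + r / norm v * (v \<bullet> v)" by (simp add: y_def inner_add_right)
    moreover have "r / norm v * (v \<bullet> v) > 0" using r assms(3) by simp
    ultimately show False by linarith
  qed
  then have "q \<in> frontier P"
    using q(1) closure_subset by (auto simp: frontier_def)
  then show thesis using that q \<open>w \<in> ?K\<close> by auto
qed

text \<open>Compare Lebesgue measures: the bound holds however the segments overlap or are arranged, so
  it can be applied to the shadows of the sides of a polygon as an unordered family.\<close>
lemma length_le_sum_covering_segments:
  fixes p q :: "'a \<Rightarrow> real"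
  assumes "finite E" "\<alpha> \<le> \<beta>" "{\<alpha><..<\<beta>} \<subseteq> (\<Union>e\<in>E. closed_segment (p e) (q e))"
  shows "\<beta> - \<alpha> \<le> (\<Sum>e\<in>E. \<bar>q e - p e\<bar>)"
proof -
  have len: "emeasure lborel (closed_segment (p e) (q e)) = ennreal \<bar>q e - p e\<bar>" for e
    by (auto simp: closed_segment_eq_real_ivl abs_if)
  have "ennreal (\<beta> - \<alpha>) = emeasure lborel {\<alpha><..<\<beta>}" using assms(2) by simp
  also have "\<dots> \<le> emeasure lborel (\<Union>e\<in>E. closed_segment (p e) (q e))"
    using assms by (intro emeasure_mono) auto
  also have "\<dots> \<le> (\<Sum>e\<in>E. emeasure lborel (closed_segment (p e) (q e)))"
    using assms(1) by (intro emeasure_subadditive_finite) auto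
  also have "\<dots> = ennreal (\<Sum>e\<in>E. \<bar>q e - p e\<bar>)" by (simp add: len)
  finally show ?thesis by (simp add: sum_nonneg)
qed

text \<open>Equality in the Cauchy--Schwarz inequality makes \<open>v\<close> a multiple of \<open>u\<close>.\<close>
lemma orthogonal_to_parallel:
  fixes u v n :: "'a::real_inner"
  assumes "\<bar>u \<bullet> v\<bar> = norm u * norm v" "n \<bullet> u = 0" "u \<noteq> 0"
  shows "n \<bullet> v = 0"
proof -
  have "norm u *\<^sub>R v = norm v *\<^sub>R u \<or> norm u *\<^sub>R v = - norm v *\<^sub>R u"
    using assms(1) by (simp add: norm_cauchy_schwarz_abs_eq)
  then have "norm u * (n \<bullet> v) = 0"
    using assms(2) by (metis inner_scaleR_right mult_zero_right)
  then show ?thesis using assms(3) by simp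
qed

text \<open>A polygonal form of the statement that a segment is the shortest path. Project onto the
  line of \<open>e0\<close>: the remaining sides close up the polygon, so their shadows cover the shadow of
  \<open>e0\<close>, and a shadow is at most as long as the side that casts it. The inequality is strict
  because the other sides cannot all be parallel to \<open>e0\<close>.\<close>
lemma edge_shorter_than_other_edges:
  fixes P :: "(real ^ 2) set"
  assumes "polytope P" "interior P \<noteq> {}" "e0 edge_of P"
  defines "E \<equiv> {e. e edge_of P} - {e0}"
  shows "diameter e0 < (\<Sum>e\<in>E. diameter e)"
proof -
  have conv: "convex P" and comp: "compact P"
    using assms(1) by (auto simp: polytope_imp_convex polytope_imp_compact)
  have "finite {e. e edge_of P}"
    using finite_polytope_faces[OF assms(1)] by (rule rev_finite_subset) (auto simp: edge_of_def)
  then have fin: "finite E" by (simp add: E_def)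
  obtain n \<beta> where n: "n \<noteq> 0" "P \<subseteq> {x. n \<bullet> x \<le> \<beta>}" "e0 = P \<inter> {x. n \<bullet> x = \<beta>}"
    using edge_supporting_line[OF assms(1-3)] by blast
  obtain a b where ab: "a \<noteq> b" "e0 = closed_segment a b"
    using edge_of_polytope_segment[OF assms(1,3)] by blast
  have "\<forall>e\<in>E. \<exists>p q. e = closed_segment p q"
    using edge_of_polytope_segment[OF assms(1)] by (auto simp: E_def)
  then obtain p q where pq: "\<And>e. e \<in> E \<Longrightarrow> e = closed_segment (p e) (q e)" by metis
  obtain c where c: "c \<in> interior P" using assms(2) by blast
  have cP: "c \<in> P" using c interior_subset by blast
  have nc: "n \<bullet> c < \<beta>" using interior_inner_less[OF n(1,2) c] .
  define u where "u = b - a"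
  have u0: "u \<noteq> 0" using ab by (simp add: u_def)
  have "a \<in> e0" "b \<in> e0" using ab by auto
  then have inP: "a \<in> P" "b \<in> P" and nab: "n \<bullet> a = \<beta>" "n \<bullet> b = \<beta>" using n(3) by auto
  have nu: "n \<bullet> u = 0" using nab by (simp add: u_def inner_diff_right)
  have uab: "u \<bullet> b - u \<bullet> a = norm u * norm u"
    by (simp add: u_def inner_diff_right[symmetric] dot_square_norm power2_eq_square)
  have "u \<bullet> b - u \<bullet> a > 0" using u0 uab by simp
  then have uless: "u \<bullet> a < u \<bullet> b" by simp
  \<comment> \<open>Every inner point of \<open>e0\<close> has the same shadow \<open>t\<close> as some point \<open>w\<close> of the polygon off the line
    of \<open>e0\<close>, taken from the triangle \<open>a b c\<close>. The point with shadow \<open>t\<close> farthest from that line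
    then lies on another side.\<close>
  have shadow: "{u \<bullet> a<..<u \<bullet> b} \<subseteq> (\<Union>e\<in>E. closed_segment (u \<bullet> p e) (u \<bullet> q e))"
  proof
    fix t assume t: "t \<in> {u \<bullet> a<..<u \<bullet> b}"
    have "\<exists>w\<in>P. u \<bullet> w = t \<and> n \<bullet> w < \<beta>"
    proof -
      have *: "\<exists>w\<in>P. u \<bullet> w = t \<and> n \<bullet> w < \<beta>"
        if d: "d \<in> P" "n \<bullet> d = \<beta>" "0 \<le> s" "s < 1" "t = (1 - s) * (u \<bullet> c) + s * (u \<bullet> d)" for s d
      proof (intro bexI conjI)
        let ?w = "(1 - s) *\<^sub>R c + s *\<^sub>R d"
        show "?w \<in> P" using conv cP d by (auto intro: convexD)
        show "u \<bullet> ?w = t" using d by (simp add: inner_add_right)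
        have "(1 - s) * (n \<bullet> c) < (1 - s) * \<beta>" using nc d by simp
        then show "n \<bullet> ?w < \<beta>" using d by (simp add: inner_add_right algebra_simps)
      qed
      show ?thesis
      proof (cases "u \<bullet> c \<le> t")
        case True
        define s where "s = (t - u \<bullet> c) / (u \<bullet> b - u \<bullet> c)"
        have "s * (u \<bullet> b - u \<bullet> c) = t - u \<bullet> c" using True t by (simp add: s_def)
        moreover have "0 \<le> s" "s < 1" using True t by (auto simp: s_def)
        ultimately show ?thesis using inP nab by (intro *[of b s]) (auto simp: algebra_simps)
      next
        case False
        define s where "s = (t - u \<bullet> c) / (u \<bullet> a - u \<bullet> c)"
        have "s * (u \<bullet> a - u \<bullet> c) = t - u \<bullet> c" using False t by (simp add: s_def)
        moreover have "0 \<le> s" "s < 1" using False t by (auto simp: s_def divide_simps)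
        ultimately show ?thesis using inP nab by (intro *[of a s]) (auto simp: algebra_simps)
      qed
    qed
    then obtain w where w: "w \<in> P" "u \<bullet> w = t" "n \<bullet> w < \<beta>" by blast
    obtain z where z: "z \<in> frontier P" "u \<bullet> z = u \<bullet> w" "(- n) \<bullet> z \<ge> (- n) \<bullet> w"
      using frontier_point_on_level[OF comp w(1), of "-n" u] n(1) nu
      by (auto simp: inner_commute)
    then have "z \<notin> e0" using w n(3) by auto
    then obtain e where e: "e \<in> E" "z \<in> e"
      using z(1) frontier_polygon_eq_Union_edges[OF assms(1,2)] by (auto simp: E_def)
    then have "z \<in> closed_segment (p e) (q e)" using pq by auto
    then have "u \<bullet> z \<in> closed_segment (u \<bullet> p e) (u \<bullet> q e)"
      using closed_segment_linear_image[of "\<lambda>x. u \<bullet> x" "p e" "q e"]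
      by (auto intro: bounded_linear.linear bounded_linear_inner_right)
    then show "t \<in> (\<Union>e\<in>E. closed_segment (u \<bullet> p e) (u \<bullet> q e))" using e z w by auto
  qed
  have cs: "\<bar>u \<bullet> q e - u \<bullet> p e\<bar> \<le> norm u * dist (p e) (q e)" for e
    using Cauchy_Schwarz_ineq2[of u "q e - p e"]
    by (simp add: inner_diff_right dist_norm norm_minus_commute)
  \<comment> \<open>If all shadows had full length, all sides would be parallel to \<open>e0\<close>, and the frontier
    would lie on finitely many levels of \<open>n\<close>, although it meets every level between \<open>c\<close> and \<open>e0\<close>.\<close>
  have "\<exists>e\<in>E. \<bar>u \<bullet> q e - u \<bullet> p e\<bar> < norm u * dist (p e) (q e)"
  proof (rule ccontr)
    assume "\<not> ?thesis"
    then have full: "\<bar>u \<bullet> q e - u \<bullet> p e\<bar> = norm u * dist (p e) (q e)" if "e \<in> E" for e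
      using cs[of e] that by (meson antisym not_less)
    have par: "n \<bullet> (q e - p e) = 0" if "e \<in> E" for e
    proof (rule orthogonal_to_parallel[OF _ nu u0])
      show "\<bar>u \<bullet> (q e - p e)\<bar> = norm u * norm (q e - p e)"
        using full[OF that] by (simp only: inner_diff_right dist_norm norm_minus_commute[of "q e"])
    qed
    have lev: "n \<bullet> z = n \<bullet> p e" if "e \<in> E" "z \<in> e" for e z
    proof -
      have "z \<in> closed_segment (p e) (q e)" using that pq by auto
      then obtain s where "z = (1 - s) *\<^sub>R p e + s *\<^sub>R q e" by (auto simp: in_segment)
      then have "z = p e + s *\<^sub>R (q e - p e)" by (simp add: algebra_simps)
      then show ?thesis using par[OF that(1)] by (simp add: inner_add_right)
    qed
    have front: "(\<lambda>x. n \<bullet> x) ` frontier P \<subseteq> insert \<beta> ((\<lambda>e. n \<bullet> p e) ` E)"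
    proof safe
      fix z assume "z \<in> frontier P" "n \<bullet> z \<notin> (\<lambda>e. n \<bullet> p e) ` E"
      then obtain e where "e edge_of P" "z \<in> e" "e \<notin> E"
        using frontier_polygon_eq_Union_edges[OF assms(1,2)] lev by blast
      then show "n \<bullet> z = \<beta>" using n(3) by (auto simp: E_def)
    qed
    have levels: "{n \<bullet> c<..<\<beta>} \<subseteq> (\<lambda>x. n \<bullet> x) ` frontier P"
    proof
      fix t assume t: "t \<in> {n \<bullet> c<..<\<beta>}"
      define s where "s = (t - n \<bullet> c) / (\<beta> - n \<bullet> c)"
      have s: "s * (\<beta> - n \<bullet> c) = t - n \<bullet> c" "0 \<le> s" "s \<le> 1" using t by (auto simp: s_def)
      let ?w = "(1 - s) *\<^sub>R c + s *\<^sub>R a"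
      have "?w \<in> P" using conv cP inP s by (auto intro: convexD)
      moreover have "n \<bullet> ?w = t" using s nab by (simp add: inner_add_right algebra_simps)
      ultimately show "t \<in> (\<lambda>x. n \<bullet> x) ` frontier P"
        using frontier_point_on_level[OF comp _ u0 nu] by (metis imageI)
    qed
    have "finite {n \<bullet> c<..<\<beta>}"
      by (rule finite_subset[OF order_trans[OF levels front]]) (use fin in auto)
    then show False using nc by (simp add: infinite_Ioo)
  qed
  then have "(\<Sum>e\<in>E. \<bar>u \<bullet> q e - u \<bullet> p e\<bar>) < (\<Sum>e\<in>E. norm u * dist (p e) (q e))"
    using fin cs by (intro sum_strict_mono_ex1) auto
  moreover have "norm u * norm u \<le> (\<Sum>e\<in>E. \<bar>u \<bullet> q e - u \<bullet> p e\<bar>)"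
    using length_le_sum_covering_segments[OF fin less_imp_le[OF uless] shadow] uab by simp
  ultimately have "norm u * norm u < norm u * (\<Sum>e\<in>E. dist (p e) (q e))"
    by (simp add: sum_distrib_left)
  then have "norm u < (\<Sum>e\<in>E. dist (p e) (q e))" using u0 by simp
  moreover have "diameter e = dist (p e) (q e)" if "e \<in> E" for e
    using pq[OF that] diameter_closed_segment by metis
  ultimately show ?thesis
    by (simp add: ab(2) diameter_closed_segment u_def dist_norm norm_minus_commute)
qed

lemma forms_polygonD:
  assumes "forms_polygon k x" "i < k"
  shows "0 < x i" "2 * x i < (\<Sum>j<k. x j)"
proof -
  obtain P :: "(real ^ 2) set" where P: "polytope P" "interior P \<noteq> {}"
    and eq: "image_mset diameter (mset_set {e. e edge_of P}) = image_mset x (mset_set {..<k})"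
    using assms(1) by (auto simp: forms_polygon_def)
  let ?E = "{e. e edge_of P}"
  have fin: "finite ?E"
    using finite_polytope_faces[OF P(1)] by (rule rev_finite_subset) (auto simp: edge_of_def)
  have "x i \<in># image_mset diameter (mset_set ?E)" unfolding eq using assms(2) by simp
  then obtain e where e: "e edge_of P" "x i = diameter e" using fin by auto
  obtain a b where "a \<noteq> b" "e = closed_segment a b"
    using edge_of_polytope_segment[OF P(1) e(1)] .
  then show "0 < x i" using e by (simp add: diameter_closed_segment)
  have "(\<Sum>j<k. x j) = (\<Sum>e\<in>?E. diameter e)"
    by (simp only: sum_unfold_sum_mset eq)
  also have "\<dots> = diameter e + (\<Sum>e\<in>?E - {e}. diameter e)"
    using fin e by (intro sum.remove) auto
  finally show "2 * x i < (\<Sum>j<k. x j)"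
    using edge_shorter_than_other_edges[OF P e(1)] e(2) by simp
qed

section \<open>Strictly convex point sequences\<close>

text \<open>Twice the signed area of the triangle \<open>p q r\<close>; it is positive when \<open>r\<close> lies to the left of the
  directed line from \<open>p\<close> to \<open>q\<close>.\<close>
definition orient :: "real ^ 2 \<Rightarrow> real ^ 2 \<Rightarrow> real ^ 2 \<Rightarrow> real" where
  "orient p q r = (q$1 - p$1) * (r$2 - p$2) - (q$2 - p$2) * (r$1 - p$1)"

definition left_normal :: "real ^ 2 \<Rightarrow> real ^ 2 \<Rightarrow> real ^ 2" where
  "left_normal p q = vector [p$2 - q$2, q$1 - p$1]"

lemma orient_rotate: "orient q r p = orient p q r"
  by (simp add: orient_def algebra_simps)

lemma orient_swap: "orient p r q = - orient p q r"
  by (simp add: orient_def algebra_simps)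

lemma orient_endpoint [simp]: "orient p q p = 0" "orient p q q = 0"
  by (simp_all add: orient_def)

lemma orient_eq_inner: "orient p q r = left_normal p q \<bullet> r - left_normal p q \<bullet> p"
  by (simp add: orient_def left_normal_def inner_vec_def sum_2 algebra_simps)

text \<open>In the plane, a linear functional that takes the value \<open>b\<close> at both \<open>p\<close> and \<open>q\<close> differs from
  \<open>b\<close> by a multiple of the signed area over \<open>p q\<close>; the scalar is normalised so as to avoid division by
  the squared length of \<open>p q\<close>.\<close>
lemma functional_constant_on_line:
  assumes "a \<bullet> p = b" "a \<bullet> q = b"
  shows "((q$1 - p$1)\<^sup>2 + (q$2 - p$2)\<^sup>2) * (a \<bullet> r - b) = (left_normal p q \<bullet> a) * orient p q r"
proof -
  have 1: "b = a$1 * p$1 + a$2 * p$2"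
    using assms(1) by (simp add: inner_vec_def sum_2)
  have 2: "b = a$1 * q$1 + a$2 * q$2"
    using assms(2) by (simp add: inner_vec_def sum_2)
  have ar: "a \<bullet> r = a$1 * r$1 + a$2 * r$2" by (simp add: inner_vec_def sum_2)
  have la: "left_normal p q \<bullet> a = (p$2 - q$2) * a$1 + (q$1 - p$1) * a$2"
    by (simp add: inner_vec_def sum_2 left_normal_def)
  show ?thesis
    unfolding ar la orient_def using 1 2 by algebra
qed

text \<open>The intersection is a face of the hull, and faces of a convex hull are spanned by
  generators.\<close>
lemma convex_hull_Int_supporting_hyperplane:
  fixes S :: "'a::euclidean_space set"
  assumes "finite S" "\<And>x. x \<in> S \<Longrightarrow> a \<bullet> x \<le> b"
  shows "convex hull S \<inter> {x. a \<bullet> x = b} = convex hull {x \<in> S. a \<bullet> x = b}"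
proof
  have "convex hull S \<subseteq> {x. a \<bullet> x \<le> b}"
    using assms by (intro hull_minimal convex_halfspace_le) auto
  then have "(convex hull S \<inter> {x. a \<bullet> x = b}) face_of (convex hull S)"
    by (intro face_of_Int_supporting_hyperplane_le) auto
  then obtain S' where S': "S' \<subseteq> S" "convex hull S \<inter> {x. a \<bullet> x = b} = convex hull S'"
    using face_of_convex_hull_subset finite_imp_compact[OF assms(1)] by metis
  moreover have "S' \<subseteq> convex hull S'" by (rule hull_subset)
  ultimately have "S' \<subseteq> {x \<in> S. a \<bullet> x = b}" by blast
  then show "convex hull S \<inter> {x. a \<bullet> x = b} \<subseteq> convex hull {x \<in> S. a \<bullet> x = b}"
    unfolding S'(2) by (rule hull_mono)
  show "convex hull {x \<in> S. a \<bullet> x = b} \<subseteq> convex hull S \<inter> {x. a \<bullet> x = b}"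
  proof (rule hull_minimal)
    show "{x \<in> S. a \<bullet> x = b} \<subseteq> convex hull S \<inter> {x. a \<bullet> x = b}"
      using hull_subset[of S convex] by auto
    show "convex (convex hull S \<inter> {x. a \<bullet> x = b})"
      by (intro convex_Int convex_convex_hull convex_hyperplane)
  qed
qed

text \<open>Positive orientation of all increasing index triples says that the points are in strictly
  convex position and are listed counterclockwise. Repeating the first point as \<open>V k\<close> lets
  every side, including the closing one, be written with \<open>j\<close> and \<open>Suc j\<close>.\<close>
locale ccw_polygon =
  fixes V :: "nat \<Rightarrow> real ^ 2" and k :: nat
  assumes k3: "k \<ge> 3"
    and closed: "V k = V 0"
    and ccw: "\<And>i j l. i < j \<Longrightarrow> j < l \<Longrightarrow> l < k \<Longrightarrow> orient (V i) (V j) (V l) > 0"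
begin

abbreviation body :: "(real ^ 2) set" where "body \<equiv> convex hull (V ` {..<k})"

abbreviation side :: "nat \<Rightarrow> (real ^ 2) set" where "side j \<equiv> closed_segment (V j) (V (Suc j))"

lemma inj_vertices: "inj_on V {..<k}"
proof (rule linorder_inj_onI)
  fix i j assume ij: "i < j" "i \<in> {..<k}" "j \<in> {..<k}"
  obtain m where m: "m < k" "m \<noteq> i" "m \<noteq> j"
  proof -
    have "\<not> {..<k} \<subseteq> {i, j}"
      using card_mono[of "{i, j}" "{..<k}"] k3 ij by auto
    then show thesis using that by auto
  qed
  then consider "m < i" | "i < m" "m < j" | "j < m" by linarith
  then have "orient (V i) (V j) (V m) \<noteq> 0"
  proof cases
    case 1
    then show ?thesis using ccw[of m i j] ij by (simp add: orient_rotate[of "V i" "V j" "V m"])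
  next
    case 2
    then show ?thesis using ccw[of i m j] ij by (simp add: orient_swap[of "V i" "V m" "V j"])
  next
    case 3
    then show ?thesis using ccw[of i j m] ij m by simp
  qed
  then show "V i \<noteq> V j" by (auto simp: orient_def)
qed auto

text \<open>A cyclic rotation brings the three indices into increasing order.\<close>
lemma side_left:
  assumes "j < k" "m < k" "V m \<noteq> V j" "V m \<noteq> V (Suc j)"
  shows "orient (V j) (V (Suc j)) (V m) > 0"
proof (cases "Suc j = k")
  case True
  have "m \<noteq> 0"
  proof
    assume "m = 0"
    then show False using assms(4) True closed by simp
  qed
  moreover have "m < j" using assms True by (auto simp: less_Suc_eq)
  ultimately show ?thesis
    using ccw[of 0 m j] True closed assms by (simp add: orient_rotate[of "V j" "V 0" "V m"] orient_rotate[of "V m" "V j" "V 0"])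
next
  case False
  have "m \<noteq> j" "m \<noteq> Suc j" using assms by auto
  then consider "m < j" | "Suc j < m" by linarith
  then show ?thesis
  proof cases
    case 1
    then show ?thesis using ccw[of m j "Suc j"] False assms by (simp add: orient_rotate[of "V j" "V (Suc j)" "V m"])
  next
    case 2
    then show ?thesis using ccw[of j "Suc j" m] assms by simp
  qed
qed

lemma side_nondegenerate: "j < k \<Longrightarrow> V j \<noteq> V (Suc j)"
proof (cases "Suc j = k")
  case True
  assume "j < k"
  have "V j \<noteq> V 0" using inj_onD[OF inj_vertices, of j 0] True k3 by auto
  then show ?thesis using True closed by simp
next
  case False
  assume "j < k"
  then show ?thesis using inj_onD[OF inj_vertices, of j "Suc j"] False by auto
qed

lemma next_vertex: "j < k \<Longrightarrow> V (Suc j) \<in> V ` {..<k}"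
proof (cases "Suc j = k")
  case True
  then have "V (Suc j) = V 0" using closed by simp
  then show ?thesis using k3 by auto
qed auto

lemma side_left_or_zero:
  assumes "j < k" "x \<in> V ` {..<k}"
  shows "orient (V j) (V (Suc j)) x \<ge> 0"
    and "orient (V j) (V (Suc j)) x = 0 \<longleftrightarrow> x \<in> {V j, V (Suc j)}"
proof -
  obtain m where m: "m < k" "x = V m" using assms(2) by auto
  have *: "x \<in> {V j, V (Suc j)} \<or> orient (V j) (V (Suc j)) x > 0"
    using side_left[OF assms(1) m(1)] m(2) by blast
  then show "orient (V j) (V (Suc j)) x \<ge> 0" by auto
  show "orient (V j) (V (Suc j)) x = 0 \<longleftrightarrow> x \<in> {V j, V (Suc j)}" using * by auto
qed

lemma side_eq_Int_line:
  assumes "j < k"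
  shows "body \<inter> {x. orient (V j) (V (Suc j)) x = 0} = side j"
    and "body \<subseteq> {x. orient (V j) (V (Suc j)) x \<ge> 0}"
proof -
  define n where "n = - left_normal (V j) (V (Suc j))"
  have or: "orient (V j) (V (Suc j)) x = n \<bullet> V j - n \<bullet> x" for x
    by (simp add: orient_eq_inner n_def)
  have le: "n \<bullet> x \<le> n \<bullet> V j" if "x \<in> V ` {..<k}" for x
    using side_left_or_zero(1)[OF assms that] or by simp
  have "body \<inter> {x. n \<bullet> x = n \<bullet> V j} = convex hull {x \<in> V ` {..<k}. n \<bullet> x = n \<bullet> V j}"
    by (rule convex_hull_Int_supporting_hyperplane) (use le in auto)
  also have "{x \<in> V ` {..<k}. n \<bullet> x = n \<bullet> V j} = {V j, V (Suc j)}"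
  proof -
    have "n \<bullet> x = n \<bullet> V j \<longleftrightarrow> x \<in> {V j, V (Suc j)}" if "x \<in> V ` {..<k}" for x
      using side_left_or_zero(2)[OF assms that] unfolding or by linarith
    moreover have "{V j, V (Suc j)} \<subseteq> V ` {..<k}" using assms next_vertex by blast
    ultimately show ?thesis by blast
  qed
  finally have "body \<inter> {x. n \<bullet> x = n \<bullet> V j} = side j" by (simp only: segment_convex_hull)
  moreover have "orient (V j) (V (Suc j)) x = 0 \<longleftrightarrow> n \<bullet> x = n \<bullet> V j" for x unfolding or by linarith
  ultimately show "body \<inter> {x. orient (V j) (V (Suc j)) x = 0} = side j" by simp
  have "body \<subseteq> {x. n \<bullet> x \<le> n \<bullet> V j}"
    using le by (intro hull_minimal convex_halfspace_le) auto
  then show "body \<subseteq> {x. orient (V j) (V (Suc j)) x \<ge> 0}" by (simp add: or)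
qed

lemma side_edge_of:
  assumes "j < k"
  shows "side j edge_of body"
proof -
  define n where "n = left_normal (V j) (V (Suc j))"
  have or: "orient (V j) (V (Suc j)) x = n \<bullet> x - n \<bullet> V j" for x
    by (simp add: orient_eq_inner n_def)
  have "(body \<inter> {x. n \<bullet> x = n \<bullet> V j}) face_of body"
    using side_eq_Int_line(2)[OF assms] unfolding or
    by (intro face_of_Int_supporting_hyperplane_ge) auto
  then have "side j face_of body"
    using side_eq_Int_line(1)[OF assms] unfolding or by simp
  moreover have "aff_dim (side j) = 1"
    using side_nondegenerate[OF assms] by (simp add: segment_convex_hull aff_dim_convex_hull)
  ultimately show ?thesis by (simp add: edge_of_def)
qed

lemma interior_body: "interior body \<noteq> {}"
proof
  assume "interior body = {}"
  then obtain a b where a: "a \<noteq> 0" and sub: "body \<subseteq> {x. a \<bullet> x = b}"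
    using empty_interior_subset_hyperplane[of body] by auto
  have on: "a \<bullet> V i = b" if "i < k" for i
  proof -
    have "V i \<in> body" using that by (intro hull_inc) auto
    then show ?thesis using sub by blast
  qed
  have "orient (V 0) (V 1) (V 2) > 0" using ccw[of 0 1 2] k3 by simp
  then have nz: "orient (V 0) (V 1) (V 2) \<noteq> 0" by simp
  have "left_normal (V 0) (V 1) \<bullet> a = 0"
    using functional_constant_on_line[of a "V 0" b "V 1" "V 2"] on[of 0] on[of 1] on[of 2] k3 nz
    by simp
  then have z: "((V 1$1 - V 0$1)\<^sup>2 + (V 1$2 - V 0$2)\<^sup>2) * (a \<bullet> r - b) = 0" for r
    using functional_constant_on_line[of a "V 0" b "V 1" r] on[of 0] on[of 1] k3 by simp
  have "(V 1$1 - V 0$1)\<^sup>2 + (V 1$2 - V 0$2)\<^sup>2 \<noteq> 0"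
    using nz by (auto simp: sum_power2_eq_zero_iff orient_def)
  then have "a \<bullet> r = b" for r using z[of r] by (metis eq_iff_diff_eq_0 mult_eq_0_iff)
  from this[of 0] this[of a] a show False by simp
qed

text \<open>An edge is spanned by two vertices \<open>V i\<close> and \<open>V j\<close>. Unless these are cyclic neighbours, there
  are vertices strictly on both sides of the line through them, so that line does not support
  the hull.\<close>
lemma edge_of_body_is_side:
  assumes "e edge_of body"
  shows "\<exists>j<k. e = side j"
proof -
  have poly: "polytope body" by (intro polytope_convex_hull) auto
  have dim: "aff_dim e = 1" using assms by (auto simp: edge_of_def)
  obtain a b where a: "a \<noteq> 0" and sub: "body \<subseteq> {x. a \<bullet> x \<le> b}"
    and e: "e = body \<inter> {x. a \<bullet> x = b}"
    using edge_supporting_line[OF poly interior_body assms] .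
  have le: "a \<bullet> V i \<le> b" if "i < k" for i
  proof -
    have "V i \<in> body" using that by (intro hull_inc) auto
    then show ?thesis using sub by blast
  qed
  have eS: "e = convex hull {x \<in> V ` {..<k}. a \<bullet> x = b}"
    unfolding e by (rule convex_hull_Int_supporting_hyperplane) (use le in auto)
  obtain i j where ij: "i < j" "j < k" "a \<bullet> V i = b" "a \<bullet> V j = b"
  proof -
    let ?S = "{x \<in> V ` {..<k}. a \<bullet> x = b}"
    have "?S \<noteq> {}"
    proof
      assume "?S = {}"
      then have "e = {}" using eS by simp
      then show False using dim by simp
    qed
    then obtain i where i: "i < k" "a \<bullet> V i = b" by auto
    have "?S \<noteq> {V i}"
    proof
      assume "?S = {V i}"
      then have "e = {V i}" using eS by simp
      then show False using dim by simp
    qed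
    then obtain j where j: "j < k" "a \<bullet> V j = b" "V j \<noteq> V i" using i by auto
    then have "i < j \<or> j < i" by (metis linorder_neqE_nat)
    then show thesis using i j that by blast
  qed
  define \<kappa> where "\<kappa> = left_normal (V i) (V j) \<bullet> a"
  define d where "d = (V j$1 - V i$1)\<^sup>2 + (V j$2 - V i$2)\<^sup>2"
  have g: "d * (a \<bullet> r - b) = \<kappa> * orient (V i) (V j) r" for r
    unfolding d_def \<kappa>_def using functional_constant_on_line ij by blast
  have "V i \<noteq> V j" using inj_onD[OF inj_vertices, of i j] ij by auto
  then have "V i$1 \<noteq> V j$1 \<or> V i$2 \<noteq> V j$2" by (auto simp: vec_eq_iff forall_2)
  then have d: "d > 0" unfolding d_def by (simp add: sum_power2_gt_zero_iff) metis
  have \<kappa>: "\<kappa> \<noteq> 0"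
  proof
    assume "\<kappa> = 0"
    then have "a \<bullet> r = b" for r using g[of r] d by simp
    from this[of 0] this[of a] a show False by simp
  qed
  have eq: "e = body \<inter> {x. orient (V i) (V j) x = 0}"
  proof -
    have "a \<bullet> x = b \<longleftrightarrow> orient (V i) (V j) x = 0" for x
      using g[of x] d \<kappa> by (metis eq_iff_diff_eq_0 less_irrefl mult_eq_0_iff)
    then show ?thesis unfolding e by simp
  qed
  \<comment> \<open>All vertices lie on one side of the supporting line, so no two of them can give
    \<open>orient (V i) (V j)\<close> opposite signs.\<close>
  have sgn: "\<kappa> * orient (V i) (V j) (V m) \<le> 0" if "m < k" for m
    unfolding g[symmetric] using le[OF that] d by (simp add: mult_le_0_iff)
  consider "j = Suc i" | "i = 0" "Suc j = k"
  proof (rule ccontr)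
    assume *: "\<not> thesis"
    have ne: "j \<noteq> Suc i" "i \<noteq> 0 \<or> Suc j \<noteq> k" using * that by auto
    have "orient (V i) (V (Suc i)) (V j) > 0" using ccw[of i "Suc i" j] ij ne by linarith
    then have "orient (V i) (V j) (V (Suc i)) < 0"
      by (simp add: orient_swap[of "V i" "V j"])
    then have "\<kappa> \<ge> 0" using sgn[of "Suc i"] ij by (simp add: mult_le_0_iff)
    moreover have "\<exists>m<k. orient (V i) (V j) (V m) > 0"
    proof (cases "i = 0")
      case True
      then have "Suc j < k" using ne ij by linarith
      then show ?thesis using ccw[of i j "Suc j"] ij by auto
    next
      case False
      then have "orient (V 0) (V i) (V j) > 0" using ccw[of 0 i j] ij by simp
      then show ?thesis using ij by (intro exI[of _ 0]) (auto simp: orient_rotate[of "V i" "V j" "V 0"])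
    qed
    then have "\<kappa> \<le> 0" using sgn by (metis mult_le_0_iff not_le)
    ultimately show False using \<kappa> by simp
  qed
  then show ?thesis
  proof cases
    case 1
    then have "i < k" using ij by simp
    then show ?thesis using eq side_eq_Int_line(1)[of i] 1 by auto
  next
    case 2
    have "orient (V i) (V j) x = - orient (V j) (V (Suc j)) x" for x
      using 2 closed by (metis orient_rotate orient_swap)
    then have "e = side j" using eq side_eq_Int_line(1)[of j] ij by simp
    then show ?thesis using ij by blast
  qed
qed

lemma inj_sides: "inj_on side {..<k}"
proof (rule linorder_inj_onI)
  fix i j assume ij: "i < j" "i \<in> {..<k}" "j \<in> {..<k}"
  show "side i \<noteq> side j"
  proof
    assume "side i = side j"
    then have s: "{V i, V (Suc i)} = {V j, V (Suc j)}" by simp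
    have inj: "V a = V b \<Longrightarrow> a = b" if "a < k" "b < k" for a b
      using inj_onD[OF inj_vertices, of a b] that by simp
    have "V i \<noteq> V j" using inj[of i j] ij by auto
    then have e: "V i = V (Suc j)" "V (Suc i) = V j" using s by (auto simp: doubleton_eq_iff)
    have "Suc i = j" using e(2) inj[of "Suc i" j] ij by simp
    moreover have "Suc j = k" using e(1) inj[of i "Suc j"] ij by fastforce
    moreover have "i = 0" using e(1) inj[of i 0] ij calculation(2) closed k3 by simp
    ultimately show False using k3 by simp
  qed
qed auto

theorem edges_of_body: "{e. e edge_of body} = side ` {..<k}"
  using side_edge_of edge_of_body_is_side by blast

end

section \<open>Inscribing a polygon with given side lengths\<close>

lemma DERIV_arcsin_mult_at_0:
  "((\<lambda>s. arcsin (s * c)) has_real_derivative c) (at 0)"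
proof -
  have "(arcsin has_real_derivative inverse (sqrt (1 - (0 * c)\<^sup>2))) (at (0 * c))"
    by (rule DERIV_arcsin) auto
  moreover have "((\<lambda>s. s * c) has_real_derivative c) (at 0)"
    by (auto intro!: derivative_eq_intros)
  ultimately show ?thesis using DERIV_chain2 by fastforce
qed

text \<open>A chord of length \<open>x i\<close> in a circle of diameter \<open>1 / s\<close> subtends a central angle \<open>2 * h i\<close> with
  \<open>sin (h i) = s * x i\<close>, and the chords close up when the half angles add up to \<open>pi\<close>. Start from the
  smallest possible circle, which has the longest stick as its diameter. If the half angles
  \<open>arcsin (s * x i)\<close> then add up to at least \<open>pi\<close>, growing the circle decreases the sum continuously
  to \<open>0\<close>, so \<open>pi\<close> is attained and the centre lies in the polygon. Otherwise the longest stick must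
  cut the centre off: with its length \<open>m\<close>, its half angle is \<open>pi - arcsin (s * m)\<close>, so the others have
  to add up to \<open>arcsin (s * m)\<close>. They add up to less on the smallest circle, and to more on very large
  ones, because there \<open>arcsin\<close> is nearly linear and the other sticks are together longer.\<close>
lemma inscribed_half_angles:
  fixes x :: "'a \<Rightarrow> real"
  assumes fin: "finite A" and ne: "A \<noteq> {}" and pos: "\<And>i. i \<in> A \<Longrightarrow> 0 < x i"
    and less: "\<And>i. i \<in> A \<Longrightarrow> 2 * x i < sum x A"
  obtains s h where "s > 0" "\<And>i. i \<in> A \<Longrightarrow> 0 < h i" "sum h A = pi" "\<And>i. i \<in> A \<Longrightarrow> sin (h i) = s * x i"
proof -
  have "Max (x ` A) \<in> x ` A" using fin ne by (intro Max_in) auto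
  then obtain M where M: "M \<in> A" "x M = Max (x ` A)" by auto
  have max: "x i \<le> x M" if "i \<in> A" for i using that fin M by simp
  define m where "m = x M"
  have m: "m > 0" using pos[OF M(1)] by (simp add: m_def)
  have rng: "0 \<le> s * x i" "s * x i \<le> 1" if "s \<in> {0..1/m}" "i \<in> A" for s i
  proof -
    have "s * x i \<le> (1/m) * m" using that max[of i] pos[of i] m
      by (intro mult_mono) (auto simp: m_def)
    then show "s * x i \<le> 1" using m by simp
    show "0 \<le> s * x i" using that pos[of i] by (auto intro: mult_nonneg_nonneg less_imp_le)
  qed
  have arc: "sin (arcsin (s * x i)) = s * x i" if "s \<in> {0..1/m}" "i \<in> A" for s i
    using rng[OF that] by simp
  have arcpos: "0 < arcsin (s * x i)" if "s \<in> {0..1/m}" "i \<in> A" "s \<noteq> 0" for s i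
  proof -
    have "0 < s * x i" using that pos[of i] by auto
    then have "arcsin 0 < arcsin (s * x i)"
      using rng(2)[OF that(1,2)] by (intro arcsin_less_arcsin) auto
    then show ?thesis by simp
  qed
  have cont: "continuous_on {0..1/m} (\<lambda>s. arcsin (s * x i))" if "i \<in> A" for i
    using rng[OF _ that] by (intro continuous_intros) (auto intro: order_trans[of _ 0])
  define F where "F s = (\<Sum>i\<in>A. arcsin (s * x i))" for s
  define G where "G s = (\<Sum>i\<in>A-{M}. arcsin (s * x i)) - arcsin (s * m)" for s
  have Fsplit: "F s = arcsin (s * m) + (\<Sum>i\<in>A-{M}. arcsin (s * x i))" for s
    unfolding F_def m_def using fin M by (intro sum.remove) auto
  show thesis
  proof (cases "F (1/m) \<ge> pi")
    case True
    have "continuous_on {0..1/m} F" unfolding F_def by (intro continuous_on_sum cont)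
    moreover have "F 0 \<le> pi" by (simp add: F_def)
    ultimately obtain s where s: "0 \<le> s" "s \<le> 1/m" "F s = pi"
      using True IVT'[of F 0 pi "1/m"] m by auto
    have "s \<noteq> 0" using s(3) by (auto simp: F_def)
    then show thesis
      using s arc arcpos by (intro that[of s "\<lambda>i. arcsin (s * x i)"]) (auto simp: F_def)
  next
    case False
    have contG: "continuous_on {0..1/m} G"
      unfolding G_def
      by (intro continuous_on_diff continuous_on_sum cont cont[OF M(1), folded m_def]) auto
    have "sum x A = m + sum x (A - {M})" unfolding m_def using fin M by (intro sum.remove) auto
    then have "0 < sum x (A - {M}) - m" using less[OF M(1)] by (simp add: m_def)
    moreover have "(G has_real_derivative (sum x (A - {M}) - m)) (at 0)"
      unfolding G_def by (intro DERIV_diff DERIV_sum DERIV_arcsin_mult_at_0)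
    ultimately obtain d where d: "d > 0" "\<And>t. t > 0 \<Longrightarrow> t < d \<Longrightarrow> G 0 < G (0 + t)"
      using DERIV_pos_inc_right by blast
    define t where "t = min (d/2) (1/m)"
    have t: "t > 0" "t < d" "t \<le> 1/m" using d(1) m by (auto simp: t_def)
    have "G t \<ge> 0" using d(2)[OF t(1,2)] by (simp add: G_def)
    moreover have "G (1/m) \<le> 0"
      using False m by (simp add: Fsplit G_def)
    moreover have "continuous_on {t..1/m} G"
      by (rule continuous_on_subset[OF contG]) (use t in auto)
    ultimately obtain s where s: "t \<le> s" "s \<le> 1/m" "G s = 0"
      using IVT2'[of G "1/m" 0 t] t by auto
    have s0: "s > 0" "s \<in> {0..1/m}" using s t by auto
    define h where "h i = (if i = M then pi - arcsin (s * m) else arcsin (s * x i))" for i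
    have "sum h A = h M + sum h (A - {M})" using fin M by (intro sum.remove) auto
    also have "sum h (A - {M}) = (\<Sum>i\<in>A-{M}. arcsin (s * x i))"
      by (intro sum.cong) (auto simp: h_def)
    also have "h M + \<dots> = pi" using s(3) by (simp add: h_def G_def)
    finally have "sum h A = pi" .
    moreover have "0 < h i" if "i \<in> A" for i
    proof (cases "i = M")
      case True
      have "arcsin (s * m) \<le> pi / 2"
        using rng[OF s0(2) M(1)] by (intro arcsin_ubound) (auto simp: m_def)
      then have "arcsin (s * m) < pi" using pi_gt_zero by linarith
      then show ?thesis using True by (simp add: h_def)
    next
      case False
      then show ?thesis using arcpos[OF s0(2) that] s0 by (simp add: h_def)
    qed
    moreover have "sin (h i) = s * x i" if "i \<in> A" for i
      using arc[OF s0(2) that] by (auto simp: h_def m_def)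
    ultimately show thesis using that s0(1) by blast
  qed
qed

definition circle_point :: "real \<Rightarrow> real \<Rightarrow> real ^ 2" where
  "circle_point R \<theta> = vector [R * cos \<theta>, R * sin \<theta>]"

lemma circle_point_periodic: "circle_point R (2 * pi) = circle_point R 0"
  by (simp add: circle_point_def)

text \<open>Half angles turn the signed area of an inscribed triangle into a product of sines, from
  which its sign can be read off.\<close>
lemma orient_circle:
  "orient (circle_point R (2 * a)) (circle_point R (2 * b)) (circle_point R (2 * c))
    = 4 * R\<^sup>2 * sin (b - a) * sin (c - b) * sin (c - a)"
proof -
  have *: "sin (2 * u) + sin (2 * v) - sin (2 * (u + v)) = 4 * sin u * sin v * sin (u + v)" for u v :: real
  proof -
    have "sin (2 * u) + sin (2 * v) = 2 * sin (u + v) * cos (u - v)"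
    proof -
      have half: "(2 * u + 2 * v) / 2 = u + v" "(2 * u - 2 * v) / 2 = u - v" by simp_all
      show ?thesis by (rule sin_plus_sin[of "2 * u" "2 * v", unfolded half])
    qed
    moreover have "sin (2 * (u + v)) = 2 * sin (u + v) * cos (u + v)" by (rule sin_double)
    moreover have "cos (u - v) - cos (u + v) = 2 * sin u * sin v"
      by (simp add: cos_diff cos_add)
    ultimately show ?thesis by algebra
  qed
  have "orient (circle_point R (2 * a)) (circle_point R (2 * b)) (circle_point R (2 * c))
    = R\<^sup>2 * (sin (2 * b - 2 * a) + sin (2 * c - 2 * b) - sin (2 * c - 2 * a))"
    unfolding orient_def circle_point_def sin_diff by (simp add: power2_eq_square algebra_simps)
  also have "\<dots> = R\<^sup>2 * (4 * sin (b - a) * sin (c - b) * sin (c - a))"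
    using *[of "b - a" "c - b"] by (simp add: algebra_simps)
  finally show ?thesis by simp
qed

lemma dist_circle_point:
  assumes "R \<ge> 0" "sin (b - a) \<ge> 0"
  shows "dist (circle_point R (2 * a)) (circle_point R (2 * b)) = 2 * R * sin (b - a)"
proof -
  have "(dist (circle_point R (2 * a)) (circle_point R (2 * b)))\<^sup>2
    = (R * cos (2 * a) - R * cos (2 * b))\<^sup>2 + (R * sin (2 * a) - R * sin (2 * b))\<^sup>2"
    unfolding dist_norm power2_norm_eq_inner
    by (simp add: inner_vec_def sum_2 circle_point_def power2_eq_square)
  also have "\<dots> = R\<^sup>2 * (2 - 2 * cos (2 * b - 2 * a))"
    unfolding cos_diff using sin_cos_squared_add[of "2 * a"] sin_cos_squared_add[of "2 * b"] by algebra
  also have "cos (2 * b - 2 * a) = 1 - 2 * (sin (b - a))\<^sup>2"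
    using cos_double_sin[of "b - a"] by (simp add: algebra_simps)
  finally have "(dist (circle_point R (2 * a)) (circle_point R (2 * b)))\<^sup>2 = (2 * R * sin (b - a))\<^sup>2"
    by (simp add: power2_eq_square algebra_simps)
  then show ?thesis using assms by (simp add: power2_eq_iff_nonneg)
qed

lemma forms_polygonI:
  assumes k: "k \<ge> 3" and pos: "\<And>i. i < k \<Longrightarrow> 0 < x i"
    and less: "\<And>i. i < k \<Longrightarrow> 2 * x i < (\<Sum>j<k. x j)"
  shows "forms_polygon k x"
proof -
  obtain s h where s: "s > 0" and h: "\<And>i. i < k \<Longrightarrow> 0 < h i" "sum h {..<k} = pi"
    "\<And>i. i < k \<Longrightarrow> sin (h i) = s * x i"
    using inscribed_half_angles[of "{..<k}" x] k pos less by (auto simp: lessThan_empty_iff bot_nat_def)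
  define R where "R = 1 / (2 * s)"
  \<comment> \<open>Half the polar angle of the \<open>j\<close>-th vertex; it reaches \<open>pi\<close> at \<open>j = k\<close>, one full turn.\<close>
  define \<phi> where "\<phi> j = sum h {..<j}" for j
  define V where "V j = circle_point R (2 * \<phi> j)" for j
  have R: "R > 0" using s by (simp add: R_def)
  have mono: "\<phi> i < \<phi> j" if "i < j" "j \<le> k" for i j
    unfolding \<phi>_def using that h(1) by (intro sum_strict_mono2[of _ _ i]) (auto intro: less_imp_le)
  have \<phi>0: "\<phi> 0 = 0" and \<phi>k: "\<phi> k = pi" using h(2) by (auto simp: \<phi>_def)
  have nonneg: "\<phi> i \<ge> 0" if "i < k" for i
    unfolding \<phi>_def using that h(1) by (intro sum_nonneg) (auto intro: less_imp_le)
  have sinpos: "sin (\<phi> j - \<phi> i) > 0" if "i < j" "j < k" for i j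
    using mono[of i j] mono[of j k] nonneg[of i] that \<phi>k by (intro sin_gt_zero) auto
  interpret ccw_polygon V k
  proof
    show "V k = V 0" by (simp add: V_def \<phi>0 \<phi>k circle_point_periodic)
    show "orient (V i) (V j) (V l) > 0" if "i < j" "j < l" "l < k" for i j l
      unfolding V_def orient_circle using sinpos[of i j] sinpos[of j l] sinpos[of i l] that R by simp
  qed (rule k)
  have len: "diameter (side j) = x j" if "j < k" for j
  proof -
    have "sin (\<phi> (Suc j) - \<phi> j) = s * x j" using h(3)[OF that] by (simp add: \<phi>_def)
    then have "dist (V j) (V (Suc j)) = 2 * R * (s * x j)"
      unfolding V_def using R s pos[OF that] by (subst dist_circle_point) auto
    then show ?thesis using s by (simp add: R_def diameter_closed_segment)
  qed
  have "image_mset diameter (mset_set {e. e edge_of body})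
      = image_mset diameter (image_mset side (mset_set {..<k}))"
    by (simp add: edges_of_body image_mset_mset_set[OF inj_sides])
  also have "\<dots> = image_mset x (mset_set {..<k})"
    unfolding multiset.map_comp by (rule image_mset_cong) (simp add: len)
  finally show ?thesis
    unfolding forms_polygon_def using interior_body
    by (intro exI[of _ body]) (auto intro: polytope_convex_hull)
qed

section \<open>The volume of the failure set\<close>

abbreviation lborel_power :: "'a set \<Rightarrow> ('a \<Rightarrow> real) measure" where
  "lborel_power A \<equiv> Pi\<^sub>M A (\<lambda>_. lborel)"

text \<open>The open coordinate conditions remove only a null set from the standard simplex, whose
  volume is known.\<close>
lemma emeasure_open_corner_simplex:
  fixes t :: real
  assumes "finite (A :: 'a set)" "t \<ge> 0"
  shows "emeasure (lborel_power A) {y \<in> space (lborel_power A). (\<forall>i\<in>A. 0 < y i) \<and> sum y A \<le> t}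
    = ennreal (t ^ card A / fact (card A))"
proof -
  interpret product_sigma_finite "\<lambda>_::'a. lborel :: real measure" by standard
  let ?S = "{x. (\<forall>i\<in>A. 0 \<le> x i) \<and> sum x A \<le> t} \<inter> space (lborel_power A)"
  let ?T = "{y \<in> space (lborel_power A). (\<forall>i\<in>A. 0 < y i) \<and> sum y A \<le> t}"
  define Z where "Z i = Pi\<^sub>E A (\<lambda>j. if j = i then {0::real} else UNIV)" for i
  have Z: "Z i \<in> null_sets (lborel_power A)" if "i \<in> A" for i
  proof
    show "Z i \<in> sets (lborel_power A)"
      unfolding Z_def using assms(1) by (intro sets_PiM_I_finite) auto
    \<comment> \<open>The factor for \<open>j = i\<close> is \<open>0\<close>, which absorbs the infinite factors.\<close>
    have "emeasure (lborel_power A) (Z i)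
        = (\<Prod>j\<in>A. emeasure lborel (if j = i then {0::real} else UNIV))"
      unfolding Z_def using assms(1) by (intro emeasure_PiM) auto
    also have "\<dots> = 0" using assms(1) that by (intro prod_zero) auto
    finally show "emeasure (lborel_power A) (Z i) = 0" .
  qed
  have "(\<Union>i\<in>A. Z i) \<in> null_sets (lborel_power A)"
    using assms(1) Z by (intro null_sets.finite_UN) auto
  then have AE: "AE y in lborel_power A. y \<notin> (\<Union>i\<in>A. Z i)"
    by (rule AE_not_in)
  have mS: "?S \<in> sets (lborel_power A)"
  proof -
    have "?S = Pi\<^sub>E A (\<lambda>_. {0..}) \<inter> ((\<lambda>x. sum x A) -` {..t} \<inter> space (lborel_power A))"
      by (auto simp: space_PiM)
    also have "\<dots> \<in> sets (lborel_power A)" using assms(1) by measurable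
    finally show ?thesis .
  qed
  have mT: "?T \<in> sets (lborel_power A)"
  proof -
    have "?T = Pi\<^sub>E A (\<lambda>_. {0<..}) \<inter> ((\<lambda>x. sum x A) -` {..t} \<inter> space (lborel_power A))"
      by (auto simp: space_PiM)
    also have "\<dots> \<in> sets (lborel_power A)" using assms(1) by measurable
    finally show ?thesis .
  qed
  have "AE y in lborel_power A. y \<in> ?T \<longleftrightarrow> y \<in> ?S"
    using AE
  proof (rule AE_mp, intro AE_I2 impI)
    fix y assume "y \<in> space (lborel_power A)" "y \<notin> (\<Union>i\<in>A. Z i)"
    then have "\<forall>i\<in>A. y i \<noteq> 0" by (fastforce simp: Z_def space_PiM PiE_iff)
    then show "y \<in> ?T \<longleftrightarrow> y \<in> ?S" by (auto simp: less_le)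
  qed
  then have "emeasure (lborel_power A) ?T = emeasure (lborel_power A) ?S"
    using mS mT by (intro emeasure_eq_AE) auto
  also have "\<dots> = ennreal (t ^ card A / fact (card A))"
    by (rule emeasure_std_simplex_aux[OF assms])
  finally show ?thesis .
qed

lemma sets_dominant_coordinate:
  fixes L :: real
  assumes "finite A" "i \<in> A"
  shows "{x \<in> Pi\<^sub>E A (\<lambda>_. {0<..<L}). sum x A \<le> 2 * x i} \<in> sets (lborel_power A)"
proof -
  have "{x \<in> Pi\<^sub>E A (\<lambda>_. {0<..<L}). sum x A \<le> 2 * x i}
      = Pi\<^sub>E A (\<lambda>_. {0<..<L}) \<inter> ((\<lambda>x. sum x A - 2 * x i) -` {..0} \<inter> space (lborel_power A))"
    by (auto simp: space_PiM)
  also have "\<dots> \<in> sets (lborel_power A)" using assms by measurable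
  finally show ?thesis .
qed

text \<open>For a fixed value \<open>t\<close> of the dominant coordinate, the other coordinates range over the corner
  simplex of size \<open>t\<close>: the bound \<open>L\<close> on them is implied by \<open>t < L\<close>. Integrating
  \<open>t ^ n / fact n\<close> over \<open>t\<close>, where \<open>n\<close> is the number of other coordinates, gives the volume.\<close>
lemma emeasure_dominant_coordinate:
  fixes L :: real
  assumes "finite A" "i \<in> A" "L > 0"
  shows "emeasure (lborel_power A) {x \<in> Pi\<^sub>E A (\<lambda>_. {0<..<L}). sum x A \<le> 2 * x i}
    = ennreal (L ^ card A / fact (card A))"
proof -
  interpret product_sigma_finite "\<lambda>_::'a. lborel :: real measure" by standard
  define I where "I = A - {i}"
  have I: "finite I" "i \<notin> I" and A: "A = insert i I" using assms by (auto simp: I_def)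
  let ?B = "{x \<in> Pi\<^sub>E A (\<lambda>_. {0<..<L}). sum x A \<le> 2 * x i}"
  let ?T = "\<lambda>t. {y \<in> space (lborel_power I). (\<forall>j\<in>I. 0 < y j) \<and> sum y I \<le> t}"
  define n where "n = card I"
  have mB: "?B \<in> sets (lborel_power (insert i I))"
    using sets_dominant_coordinate[OF assms(1,2)] A by simp
  have mT: "?T t \<in> sets (lborel_power I)" for t
  proof -
    have "?T t = Pi\<^sub>E I (\<lambda>_. {0<..}) \<inter> ((\<lambda>x. sum x I) -` {..t} \<inter> space (lborel_power I))"
      by (auto simp: space_PiM)
    also have "\<dots> \<in> sets (lborel_power I)" using I(1) by measurable
    finally show ?thesis .
  qed
  have slice: "indicator ?B (y(i := t)) = (indicator {0<..<L} t * indicator (?T t) y :: ennreal)"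
    if "y \<in> space (lborel_power I)" for y t
  proof -
    have "sum (y(i := t)) A = t + sum y I"
      unfolding A using I by (simp add: sum.insert) (intro sum.cong, auto)
    moreover have "y(i := t) \<in> Pi\<^sub>E A (\<lambda>_. {0<..<L}) \<longleftrightarrow> t \<in> {0<..<L} \<and> (\<forall>j\<in>I. y j \<in> {0<..<L})"
      using that I unfolding A by (auto simp: space_PiM PiE_iff extensional_def)
    moreover have "y j < L" if "j \<in> I" "\<forall>j\<in>I. 0 < y j" "sum y I \<le> t" "t < L" for j
    proof -
      have "y j \<le> sum y I" using that I by (intro member_le_sum) (auto intro: less_imp_le)
      then show ?thesis using that by linarith
    qed
    ultimately have "y(i := t) \<in> ?B \<longleftrightarrow> t \<in> {0<..<L} \<and> y \<in> ?T t"
      using that by auto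
    then show ?thesis by (auto simp: indicator_def)
  qed
  have "emeasure (lborel_power A) ?B = (\<integral>\<^sup>+ x. indicator ?B x \<partial>lborel_power (insert i I))"
    using mB by (simp add: A[symmetric])
  also have "\<dots> = (\<integral>\<^sup>+ t. \<integral>\<^sup>+ y. indicator ?B (y(i := t)) \<partial>lborel_power I \<partial>lborel)"
    using I mB by (intro product_nn_integral_insert_rev) auto
  also have "\<dots> = (\<integral>\<^sup>+ t. \<integral>\<^sup>+ y. indicator {0<..<L} t * indicator (?T t) y \<partial>lborel_power I \<partial>lborel)"
    by (intro nn_integral_cong slice)
  also have "\<dots> = (\<integral>\<^sup>+ t. indicator {0<..<L} t * emeasure (lborel_power I) (?T t) \<partial>lborel)"
    using mT by (intro nn_integral_cong) (simp add: nn_integral_cmult)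
  also have "\<dots> = (\<integral>\<^sup>+ t. ennreal (t ^ n / fact n) * indicator {0..L} t \<partial>lborel)"
  proof (rule nn_integral_cong_AE)
    have "AE t in lborel. t \<noteq> 0 \<and> t \<noteq> L"
      using AE_lborel_singleton[of 0] AE_lborel_singleton[of L] by eventually_elim auto
    then show "AE t in lborel. indicator {0<..<L} t * emeasure (lborel_power I) (?T t)
        = ennreal (t ^ n / fact n) * indicator {0..L} t"
    proof eventually_elim
      case (elim t)
      show ?case
      proof (cases "t \<in> {0<..<L}")
        case True
        then show ?thesis using emeasure_open_corner_simplex[OF I(1), of t] by (simp add: n_def)
      next
        case False
        then show ?thesis using elim by (auto simp: indicator_def)
      qed
    qed
  qed
  also have "\<dots> = ennreal (L ^ Suc n / fact (Suc n) - 0 ^ Suc n / fact (Suc n))"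
  proof (rule nn_integral_FTC_Icc)
    fix t assume "t \<in> {0..L}"
    have "((\<lambda>t. t ^ Suc n / fact (Suc n)) has_real_derivative
        (real (Suc n) * t ^ n / fact (Suc n))) (at t)"
      using DERIV_cdivide[OF DERIV_pow[of "Suc n" t UNIV], of "fact (Suc n)"]
      by (simp only: diff_Suc_1 diff_Suc_Suc minus_nat.diff_0)
    moreover have "real (Suc n) * t ^ n / fact (Suc n) = t ^ n / fact n"
      by (simp del: of_nat_Suc)
    ultimately show "((\<lambda>t. t ^ Suc n / fact (Suc n)) has_real_derivative t ^ n / fact n) (at t)"
      by simp
  qed (use assms in auto)
  also have "Suc n = card A" unfolding A n_def using I by simp
  finally have "emeasure (lborel_power A) ?B
      = ennreal (L ^ card A / fact (card A) - 0 ^ card A / fact (card A))" .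
  moreover have "card A \<noteq> 0" using assms(1,2) by auto
  ultimately show ?thesis by (simp add: zero_power)
qed

text \<open>The failure events for different sticks are disjoint, so their \<open>k\<close> volumes
  \<open>L ^ k / fact k\<close> add up to \<open>L ^ k / fact (k - 1)\<close>.\<close>
lemma measure_no_dominant_stick:
  assumes "k \<ge> 3" "L > 0"
  shows "measure (stick_space k L)
      {x \<in> space (stick_space k L). \<forall>i<k. 0 < x i \<and> 2 * x i < (\<Sum>j<k. x j)} = 1 - 1 / fact (k - 1)"
proof -
  interpret product_sigma_finite "\<lambda>_::nat. lborel :: real measure" by standard
  let ?M = "lborel_power {..<k}"
  let ?C = "Pi\<^sub>E {..<k} (\<lambda>_. {0<..<L})"
  let ?G = "{x \<in> space ?M. \<forall>i<k. 0 < x i \<and> 2 * x i < (\<Sum>j<k. x j)}"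
  define B where "B i = {x \<in> ?C. sum x {..<k} \<le> 2 * x i}" for i
  have mC: "?C \<in> sets ?M" by (intro sets_PiM_I_finite) auto
  have comp: "(\<lambda>x. x j) \<in> borel_measurable ?M" if "j \<in> {..<k}" for j
    using measurable_component_singleton[OF that, of "\<lambda>_. lborel :: real measure"] by simp
  have diff: "(\<lambda>x. (\<Sum>j<k. x j) - 2 * x i) \<in> borel_measurable ?M" if "i \<in> {..<k}" for i
    using that by (intro borel_measurable_diff borel_measurable_sum borel_measurable_times comp) auto
  have "{x \<in> space ?M. \<forall>i\<in>{..<k}. 0 < x i \<and> 2 * x i < (\<Sum>j<k. x j)} \<in> sets ?M"
  proof (rule sets.sets_Collect_finite_All')
    fix i assume i: "i \<in> {..<k}"
    have "((\<lambda>x. x i) -` {0<..} \<inter> space ?M) \<inter> ((\<lambda>x. (\<Sum>j<k. x j) - 2 * x i) -` {0<..} \<inter> space ?M)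
        \<in> sets ?M"
      by (intro sets.Int measurable_sets[OF comp[OF i]] measurable_sets[OF diff[OF i]]) auto
    also have "((\<lambda>x. x i) -` {0<..} \<inter> space ?M) \<inter> ((\<lambda>x. (\<Sum>j<k. x j) - 2 * x i) -` {0<..} \<inter> space ?M)
        = {x \<in> space ?M. 0 < x i \<and> 2 * x i < (\<Sum>j<k. x j)}"
      by auto
    finally show "{x \<in> space ?M. 0 < x i \<and> 2 * x i < (\<Sum>j<k. x j)} \<in> sets ?M" .
  qed (use assms in \<open>auto simp: lessThan_empty_iff bot_nat_def\<close>)
  then have mG: "?G \<in> sets ?M" by (simp only: Ball_def lessThan_iff)
  have mB: "B i \<in> sets ?M" if "i < k" for i
    unfolding B_def using that by (intro sets_dominant_coordinate) auto
  have eC: "emeasure ?M ?C = ennreal (L ^ k)"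
    using assms by (subst emeasure_PiM) (auto simp: ennreal_power)
  have eB: "emeasure ?M (B i) = ennreal (L ^ k / fact k)" if "i < k" for i
    unfolding B_def using emeasure_dominant_coordinate[of "{..<k}" i L] that assms by simp
  have fB: "B i \<in> fmeasurable ?M" if "i < k" for i
    using mB[OF that] eB[OF that] by (auto intro: fmeasurableI)
  \<comment> \<open>Two sticks cannot both be at least half of the total when a third one has positive length.\<close>
  have disj: "disjoint_family_on B {..<k}"
  proof (unfold disjoint_family_on_def, intro ballI impI equals0I)
    fix i j x assume ij: "i \<in> {..<k}" "j \<in> {..<k}" "i \<noteq> j" and x: "x \<in> B i \<inter> B j"
    have "\<not> {..<k} \<subseteq> {i, j}"
    proof
      assume "{..<k} \<subseteq> {i, j}"
      then have "card {..<k} \<le> card {i, j}" by (intro card_mono) auto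
      also have "\<dots> \<le> 2" by (simp add: card_insert_if)
      finally show False using assms by simp
    qed
    then obtain m where m: "m < k" "m \<noteq> i" "m \<noteq> j" by auto
    have pos: "0 < x l" if "l < k" for l using x that by (auto simp: B_def PiE_iff)
    have "x i + x j + x m = sum x {i, j, m}" using ij m by (simp add: add.assoc)
    also have "\<dots> \<le> sum x {..<k}" using ij m pos by (intro sum_mono2) (auto intro: less_imp_le)
    finally have "x i + x j + x m \<le> sum x {..<k}" .
    then show False using x pos[OF m(1)] by (auto simp: B_def)
  qed
  have CG: "?C \<inter> ?G = ?C - (\<Union>i<k. B i)"
    by (auto simp: B_def space_PiM PiE_iff not_le)
  have UB: "measure ?M (\<Union>i<k. B i) = (\<Sum>i<k. L ^ k / fact k)"
    using assms fB disj eB by (subst measure_finite_Union) (auto simp: fmeasurableD measure_def)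
  have "measure ?M (?C \<inter> ?G) = measure ?M ?C - measure ?M (\<Union>i<k. B i)"
    unfolding CG using mC mB eC by (intro measure_Diff) (auto simp: B_def)
  also have "\<dots> = L ^ k - real k * (L ^ k / fact k)"
    using eC UB assms by (simp add: measure_def)
  also have "real k * (L ^ k / fact k) = L ^ k / fact (k - 1)"
    using assms by (simp add: fact_reduce)
  finally have CGm: "measure ?M (?C \<inter> ?G) = L ^ k * (1 - 1 / fact (k - 1))"
    by (simp add: algebra_simps)
  have mCm: "measure ?M ?C = L ^ k" using eC assms by (simp add: measure_def)
  have "measure (stick_space k L) ?G = measure ?M (?C \<inter> ?G) / measure ?M ?C"
    unfolding stick_space_def using mG eC assms by (intro measure_uniform_measure) auto
  also have "\<dots> = 1 - 1 / fact (k - 1)"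
    unfolding CGm mCm using assms by simp
  finally show ?thesis by (simp add: stick_space_def)
qed

section \<open>The probability of forming a polygon\<close>

theorem corollary5:
  fixes k :: nat and L :: real
  assumes "k \<ge> 3" and "L > 0"
  shows "measure (stick_space k L) {x \<in> space (stick_space k L). forms_polygon k x}
           = 1 - 1 / fact (k - 1)"
proof -
  have "forms_polygon k x \<longleftrightarrow> (\<forall>i<k. 0 < x i \<and> 2 * x i < (\<Sum>j<k. x j))" for x
    using forms_polygonI[OF assms(1), of x] forms_polygonD[of k x] by blast
  then show ?thesis using measure_no_dominant_stick[OF assms] by (simp only:)
qed

end
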